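(* For all positive integers $k,R,S$ with $1\le S<R$ and every integer $n\ge1$, the coefficient of $q^n$ in $$\mathcal T_{R,S,k}(q)=\frac{\sum_{j=k}^{\infty}(-1)^{j-k}q^{Rj(j+1)/2-Sj}\left(1-q^{(2j+1)S}\right)}{\left(q^S,q^{R-S};q^R\right)_\infty}$$ is nonnegative.
   Context: Here $(a;q)_\infty=\prod_{n\ge0}(1-aq^n)$ and $(a_1,\dots,a_t;q)_\infty=\prod_{i=1}^t(a_i;q)_\infty$, so $(q^S,q^{R-S};q^R)_\infty=\prod_{n\ge0}(1-q^{S+nR})(1-q^{R-S+nR})$. All series are formal power series in $q$. *)

theory Defs
  imports "HOL-Analysis.Infinite_Products" "HOL-Computational_Algebra.Formal_Power_Series"
begin

text \<open>
  The formal variable \<open>q\<close> is \<^const>\<open>fps_X\<close>. Coefficients are taken in \<^typ>\<open>rat\<close> because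
  division of formal power series needs an inverse on the coefficients. Infinite sums and
  products are limits in the X-adic topology of \<^typ>\<open>rat fps\<close>; the lemmas below show that
  those used here do converge.
\<close>

definition qpochhammer_inf :: "rat fps \<Rightarrow> rat fps \<Rightarrow> rat fps" where
  "qpochhammer_inf a p = (\<Prod>n. 1 - a * p ^ n)"

definition qpochhammers_inf :: "rat fps list \<Rightarrow> rat fps \<Rightarrow> rat fps" where
  "qpochhammers_inf as p = (\<Prod>a\<leftarrow>as. qpochhammer_inf a p)"

text \<open>
  For \<open>S < R\<close> both \<^const>\<open>divide\<close> and \<^const>\<open>minus\<close> on exponents are exact here:
  \<open>j (j + 1)\<close> is even and \<open>R j (j + 1) / 2 \<ge> S j\<close>.
\<close>

definition tail_term :: "nat \<Rightarrow> nat \<Rightarrow> nat \<Rightarrow> nat \<Rightarrow> rat fps" where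
  "tail_term R S k j =
     (-1) ^ (j - k) * fps_X ^ (R * j * (j + 1) div 2 - S * j) * (1 - fps_X ^ ((2 * j + 1) * S))"

definition truncated_triple :: "nat \<Rightarrow> nat \<Rightarrow> nat \<Rightarrow> rat fps" where
  "truncated_triple R S k =
     (\<Sum>j. if k \<le> j then tail_term R S k j else 0) /
     qpochhammers_inf [fps_X ^ S, fps_X ^ (R - S)] (fps_X ^ R)"

lemma exponent_le:
  fixes R S j :: nat
  assumes "S < R"
  shows "S * j + j \<le> R * j * (j + 1) div 2"
proof -
  have "2 * j \<le> j * (j + 1)" by (cases j) simp_all
  hence "Suc S * (2 * j) \<le> R * (j * (j + 1))"
    by (rule mult_le_mono[OF Suc_leI[OF assms]])
  moreover have "Suc S * (2 * j) = (S * j + j) * 2" by (simp add: algebra_simps)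
  ultimately have "(S * j + j) * 2 \<le> R * j * (j + 1)" by (simp only: mult.assoc)
  thus ?thesis by (simp only: less_eq_div_iff_mult_less_eq zero_less_numeral)
qed

lemma exponent_exact:
  fixes R S j :: nat
  assumes "S < R"
  shows "real (R * j * (j + 1) div 2 - S * j) = real R * real j * (real j + 1) / 2 - real S * real j"
proof -
  have ev: "even (R * j * (j + 1))" by simp
  have "S * j \<le> R * j * (j + 1) div 2" using exponent_le[OF assms, of j] by linarith
  hence "real (R * j * (j + 1) div 2 - S * j) = real (R * j * (j + 1) div 2) - real (S * j)"
    by (rule of_nat_diff)
  also have "real (R * j * (j + 1) div 2) = real (R * j * (j + 1)) / 2"
    using ev by (simp only: real_of_nat_div of_nat_numeral)
  finally show ?thesis by (simp add: algebra_simps)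
qed

lemma fps_LIMSEQ_I:
  fixes f :: "nat \<Rightarrow> rat fps"
  assumes "\<And>m n. n \<le> m \<Longrightarrow> fps_nth (f (Suc m)) n = fps_nth (f m) n"
  shows "f \<longlonglongrightarrow> Abs_fps (\<lambda>n. fps_nth (f n) n)"
proof (rule tendsto_fpsI)
  fix n
  have "fps_nth (f m) n = fps_nth (f n) n" if "n \<le> m" for m
    using that by (induction m rule: dec_induct) (auto simp: assms)
  thus "\<forall>\<^sub>F m in sequentially. fps_nth (f m) n = fps_nth (Abs_fps (\<lambda>n. fps_nth (f n) n)) n"
    unfolding eventually_sequentially fps_nth_Abs_fps by blast
qed

lemma summable_tail_terms:
  assumes "S < R"
  shows "summable (\<lambda>j. if k \<le> j then tail_term R S k j else 0)"
proof -
  have z: "fps_nth (tail_term R S k j) n = 0" if "n < j" for n j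
  proof -
    have "n < R * j * (j + 1) div 2 - S * j" using exponent_le[OF assms, of j] that by linarith
    thus ?thesis
      unfolding tail_term_def mult.commute[of "(-1) ^ (j - k)"] mult.assoc
      by (subst fps_X_power_mult_nth) simp
  qed
  have "(\<lambda>N. \<Sum>j<Suc N. if k \<le> j then tail_term R S k j else 0) \<longlonglongrightarrow>
        Abs_fps (\<lambda>n. fps_nth (\<Sum>j<Suc n. if k \<le> j then tail_term R S k j else 0) n)"
    by (rule fps_LIMSEQ_I) (simp add: z)
  from LIMSEQ_imp_Suc[OF this] show ?thesis unfolding summable_def sums_def by (rule exI)
qed

lemma has_prod_qpochhammer_inf:
  assumes "fps_nth a 0 = 0" and "fps_nth p 0 = 0"
  shows "(\<lambda>n. 1 - a * p ^ n) has_prod qpochhammer_inf a p"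
    and "fps_nth (qpochhammer_inf a p) 0 = 1"
proof -
  define f where "f = (\<lambda>N. \<Prod>n\<le>N. 1 - a * p ^ n)"
  define L where "L = Abs_fps (\<lambda>n. fps_nth (f n) n)"
  have "fps_nth (a * f m * p ^ Suc m) n = 0" if "n \<le> m" for m n
  proof -
    have "fps_nth (p ^ Suc m) (n - i) = 0" for i
      using startsby_zero_power_prefix[OF assms(2), of "Suc m"] that by (simp del: power_Suc)
    thus ?thesis unfolding fps_mult_nth[of "a * f m"] by (simp del: power_Suc)
  qed
  hence "f \<longlonglongrightarrow> L"
    unfolding L_def by (intro fps_LIMSEQ_I) (simp add: f_def algebra_simps)
  moreover have L0: "fps_nth L 0 = 1" by (simp add: L_def f_def assms(1))
  ultimately have *: "(\<lambda>n. 1 - a * p ^ n) has_prod L"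
    unfolding has_prod_def raw_has_prod_def f_def by auto
  hence "L = qpochhammer_inf a p" unfolding qpochhammer_inf_def by (rule has_prod_unique)
  with * L0 show "(\<lambda>n. 1 - a * p ^ n) has_prod qpochhammer_inf a p"
    and "fps_nth (qpochhammer_inf a p) 0 = 1" by auto
qed

end

theory Submission
  imports Defs
begin

text \<open>
  Put \<open>x = X^S\<close>, \<open>y = X^(R-S)\<close> and \<open>q = x y = X^R\<close>. By Euler's expansion of \<open>1 / (x; q)_inf\<close> and
  \<open>1 / (y; q)_inf\<close>, dividing by the product means multiplying by the double series whose
  \<open>(a, b)\<close> entry is the weight \<open>w(a,b) = x^a y^b / ((q;q)_a (q;q)_b)\<close>.

  The numerator is a sum over \<open>j \<ge> k\<close> of \<open>(-1)^(j-k) t_j\<close>, with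
  \<open>t_j = q^(j choose 2) y^j - q^(j+1 choose 2) x^(j+1)\<close>. Let \<open>p_j(A)\<close> be the monic polynomial
  with roots \<open>1, q, ..., q^(j-1)\<close> and let \<open>d_j(A,B) = (p_j(A) - p_j(B)) / (A - B)\<close> be its divided
  difference; write \<open>A = q^a\<close> and \<open>B = q^b\<close>. Multiplying the double series by \<open>(-1)^j t_j\<close> amounts
  to weighting its entries by \<open>p_j(B) + p_(j+1)(A)\<close> (\<open>euler_sum_node_poly\<close>). This weighted sum
  is the same as the one with \<open>A (d_(j+1) - d_j)\<close>: after multiplication by \<open>w(a,b)\<close> the two
  differ by a function minus its translate along the diagonals \<open>a - b = const\<close> (\<open>weight_divdiff_step\<close>, \<open>flow_Suc\<close>). Hence the
  sum over \<open>j\<close> telescopes, and the quotient is, up to the sign \<open>(-1)^k\<close>, the limit of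
  the sums of \<open>w(a,b) A (d_K - d_k)\<close> as \<open>K\<close> grows.

  The signs can now be read off. If \<open>a \<noteq> b\<close> are both below \<open>k\<close>, then \<open>q^a\<close> and \<open>q^b\<close> are both roots of
  \<open>p_k\<close>, so \<open>d_k\<close> vanishes; if one of them is at least \<open>k\<close>, then \<open>(-1)^(k-1) d_k\<close>
  divided by the two q-factorials has nonnegative coefficients (\<open>nonneg_divdiff\<close>). What remains
  are the diagonal entries \<open>a = b < k\<close> of the sum with \<open>d_k\<close> and \<open>a = b < K\<close> of the sum
  with \<open>d_K\<close>, which have no constant sign. The telescoping
  works on the diagonal alone and evaluates their contribution as the alternating sum of
  \<open>D_j = q^(j+1 choose 2) / (q;q)_j\<close> over \<open>j \<ge> k\<close>, with a plus sign at \<open>j = k\<close>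
  (\<open>diagonal_sum_telescope\<close>). Each negative term \<open>D_j\<close>, \<open>j = k + 2 i + 1\<close>, is dominated
  by the entry at \<open>a = b = k + i\<close> (\<open>diagonal_term_dominates\<close>): with \<open>r = k + i\<close> and \<open>s = i + 1\<close> one has
  \<open>j = r + s\<close>, that entry is at least a power of \<open>q\<close> divided by \<open>(q;q)_r (q;q)_s\<close>, and
  \<open>1 / ((q;q)_r (q;q)_s)\<close> dominates \<open>1 / (q;q)_(r+s)\<close>.

  All this is done with finite squares \<open>a, b \<le> N\<close>, whose sums agree with the infinite
  ones in all coefficients below \<open>N\<close>.
\<close>

section \<open>Formal power series with nonnegative coefficients\<close>

definition nonneg_coeffs :: "rat fps \<Rightarrow> bool" where
  "nonneg_coeffs f \<longleftrightarrow> (\<forall>n. 0 \<le> fps_nth f n)"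

lemma nonneg_coeffsD: "nonneg_coeffs f \<Longrightarrow> 0 \<le> fps_nth f n"
  by (simp add: nonneg_coeffs_def)

lemma nonneg_coeffs_0: "nonneg_coeffs 0"
  and nonneg_coeffs_1: "nonneg_coeffs 1"
  by (simp_all add: nonneg_coeffs_def)

lemma nonneg_coeffs_X_power: "nonneg_coeffs (fps_X ^ n)"
  by (simp add: nonneg_coeffs_def fps_X_power_nth)

lemma nonneg_coeffs_add: "nonneg_coeffs f \<Longrightarrow> nonneg_coeffs g \<Longrightarrow> nonneg_coeffs (f + g)"
  by (simp add: nonneg_coeffs_def)

lemma nonneg_coeffs_mult: "nonneg_coeffs f \<Longrightarrow> nonneg_coeffs g \<Longrightarrow> nonneg_coeffs (f * g)"
  by (simp add: nonneg_coeffs_def fps_mult_nth sum_nonneg)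

lemma nonneg_coeffs_power: "nonneg_coeffs f \<Longrightarrow> nonneg_coeffs (f ^ n)"
  by (induction n) (simp_all add: nonneg_coeffs_1 nonneg_coeffs_mult)

lemma nonneg_coeffs_sum: "(\<And>i. i \<in> I \<Longrightarrow> nonneg_coeffs (f i)) \<Longrightarrow> nonneg_coeffs (sum f I)"
  by (simp add: nonneg_coeffs_def fps_sum_nth sum_nonneg)

lemmas nonneg_coeffs_intros =
  nonneg_coeffs_add nonneg_coeffs_mult nonneg_coeffs_power nonneg_coeffs_1 nonneg_coeffs_0

lemma nonneg_coeffs_prod: "(\<And>l. l < j \<Longrightarrow> nonneg_coeffs (f l)) \<Longrightarrow> nonneg_coeffs (\<Prod>l<(j::nat). f l)"
  by (induction j) (simp_all add: nonneg_coeffs_intros)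

lemma nonneg_coeffs_trans:
  "nonneg_coeffs (f - g) \<Longrightarrow> nonneg_coeffs (g - h) \<Longrightarrow> nonneg_coeffs (f - h)"
  using nonneg_coeffs_add[of "f - g" "g - h"] by simp

text \<open>
  The coefficients of \<open>f = 1 / (1 - u)\<close> are determined recursively by \<open>f = 1 + u f\<close>.
\<close>

lemma nonneg_coeffs_geometric:
  assumes "nonneg_coeffs u" and "fps_nth u 0 = 0"
  shows "nonneg_coeffs (inverse (1 - u))"
proof -
  define f where "f = inverse (1 - u)"
  have "f * (1 - u) = 1" unfolding f_def by (rule inverse_mult_eq_1) (simp add: assms(2))
  hence f: "f = 1 + u * f" by (simp add: algebra_simps)
  have "0 \<le> fps_nth f n" for n
  proof (induction n rule: less_induct)
    case (less n)
    have "0 \<le> fps_nth u i * fps_nth f (n - i)" if "i \<le> n" for i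
      using that less assms by (cases "i = 0") (auto simp: nonneg_coeffs_def)
    hence "0 \<le> fps_nth (1 :: rat fps) n + fps_nth (u * f) n"
      by (auto simp: fps_mult_nth fps_one_nth intro!: sum_nonneg)
    thus ?case by (subst f) simp
  qed
  thus ?thesis by (simp add: nonneg_coeffs_def f_def)
qed

section \<open>Agreement of power series up to a given order\<close>

definition agree_below :: "nat \<Rightarrow> rat fps \<Rightarrow> rat fps \<Rightarrow> bool" where
  "agree_below N f g \<longleftrightarrow> (\<forall>n<N. fps_nth f n = fps_nth g n)"

lemma agree_below_refl: "agree_below N f f"
  by (simp add: agree_below_def)

lemma agree_below_sym: "agree_below N f g \<Longrightarrow> agree_below N g f"
  by (simp add: agree_below_def)

lemma agree_below_trans [trans]:
  "agree_below N f g \<Longrightarrow> agree_below N g h \<Longrightarrow> agree_below N f h"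
  by (simp add: agree_below_def)

lemma agree_below_add:
  "agree_below N f g \<Longrightarrow> agree_below N f' g' \<Longrightarrow> agree_below N (f + f') (g + g')"
  by (simp add: agree_below_def)

lemma agree_below_diff:
  "agree_below N f g \<Longrightarrow> agree_below N f' g' \<Longrightarrow> agree_below N (f - f') (g - g')"
  by (simp add: agree_below_def)

lemma agree_below_mult:
  "agree_below N f g \<Longrightarrow> agree_below N f' g' \<Longrightarrow> agree_below N (f * f') (g * g')"
  by (auto simp: agree_below_def fps_mult_nth intro!: sum.cong)

lemma agree_below_sum:
  "(\<And>i. i \<in> I \<Longrightarrow> agree_below N (f i) (g i)) \<Longrightarrow> agree_below N (sum f I) (sum g I)"
  by (auto simp: agree_below_def fps_sum_nth intro!: sum.cong)

lemma agree_below_0_power: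
  assumes "fps_nth x 0 = 0" and "N \<le> M"
  shows "agree_below N (x ^ M * f) 0"
proof -
  have "fps_nth (x ^ M * f) n = 0" if "n < N" for n
    unfolding fps_mult_nth using that assms startsby_zero_power_prefix[of x M]
    by (auto intro!: sum.neutral)
  thus ?thesis by (simp add: agree_below_def)
qed

text \<open>
  Enlarging a square of indices is harmless when the new entries have order at least \<open>N\<close>.
\<close>

lemma agree_below_square:
  assumes "\<And>i. agree_below N (f i N) 0" and "\<And>i. agree_below N (f N i) 0"
  shows "agree_below N (\<Sum>a\<le>N. \<Sum>b\<le>N. f a b) (\<Sum>a<N. \<Sum>b<N. f a b)"
proof -
  have "agree_below N (\<Sum>a\<le>N. \<Sum>b\<le>N. f a b) (\<Sum>a<N. \<Sum>b\<le>N. f a b)"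
    using agree_below_add[OF agree_below_refl agree_below_sum[of "{..N}" N "f N" "\<lambda>_. 0"]] assms(2)
    by (simp add: lessThan_Suc_atMost[symmetric])
  also have "agree_below N \<dots> (\<Sum>a<N. \<Sum>b<N. f a b)"
  proof (rule agree_below_sum)
    fix a
    show "agree_below N (\<Sum>b\<le>N. f a b) (\<Sum>b<N. f a b)"
      using agree_below_add[OF agree_below_refl assms(1)[of a]]
      by (simp add: lessThan_Suc_atMost[symmetric])
  qed
  finally show ?thesis .
qed

section \<open>Divided differences at a geometric progression of nodes\<close>

definition node_poly :: "'a::comm_ring_1 \<Rightarrow> nat \<Rightarrow> 'a \<Rightarrow> 'a" where
  "node_poly q k A = (\<Prod>l<k. A - q ^ l)"

text \<open>
  The polynomial \<open>(p(A) - p(B)) / (A - B)\<close> for \<open>p = node_poly q k\<close>, given by a recursion because its values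
  on the diagonal \<open>A = B\<close>, where the quotient is meaningless, are needed as well.
\<close>

primrec divdiff :: "'a::comm_ring_1 \<Rightarrow> nat \<Rightarrow> 'a \<Rightarrow> 'a \<Rightarrow> 'a" where
  "divdiff q 0 A B = 0"
| "divdiff q (Suc k) A B = (B - q ^ k) * divdiff q k A B + node_poly q k A"

lemma node_poly_0 [simp]: "node_poly q 0 A = 1"
  and node_poly_Suc: "node_poly q (Suc k) A = (A - q ^ k) * node_poly q k A"
  by (simp_all add: node_poly_def mult.commute)

lemma node_poly_eq_0: "l < k \<Longrightarrow> node_poly q k (q ^ l) = 0"
  by (auto simp: node_poly_def intro!: prod_zero)

lemma node_poly_scaled:
  "node_poly q (Suc k) (q * A) = q ^ k * (q * A - 1) * node_poly q k A"
proof -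
  have "node_poly q (Suc k) (q * A) = (q * A - 1) * (\<Prod>l<k. q * (A - q ^ l))"
    unfolding node_poly_def by (subst prod.lessThan_Suc_shift) (simp add: algebra_simps)
  thus ?thesis by (simp add: node_poly_def prod.distrib mult_ac)
qed

lemma divdiff_diff: "(A - B) * divdiff q k A B = node_poly q k A - node_poly q k B"
proof (induction k)
  case (Suc k)
  have "(A - B) * divdiff q (Suc k) A B =
        (B - q ^ k) * ((A - B) * divdiff q k A B) + (A - B) * node_poly q k A"
    by (simp add: algebra_simps)
  thus ?case unfolding Suc by (simp add: node_poly_Suc algebra_simps)
qed simp

text \<open>
  Both this recursion and the defining one are needed: each peels off the factor in one of the two
  variables, and only one of them keeps the signs under control (see \<open>nonneg_divdiff_partial_denominator\<close>).
\<close>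

lemma divdiff_Suc': "divdiff q (Suc k) A B = (A - q ^ k) * divdiff q k A B + node_poly q k B"
  using divdiff_diff[of A B q k] by (simp add: algebra_simps)

lemma divdiff_commute: "divdiff q k A B = divdiff q k B A"
  by (induction k) (simp_all add: divdiff_Suc'[of q _ B A] del: divdiff.simps(2), simp)

text \<open>
  Scaling by \<open>q\<close> moves each node to the next one, so the scaled divided difference at \<open>k + 1\<close>
  nodes differs from that at \<open>k\<close> nodes only by the contribution of the lost node \<open>1\<close>.
\<close>

lemma divdiff_scaled:
  "q * divdiff q (Suc k) (q * A) (q * B) =
     (q * A - 1) * q ^ k * divdiff q k A B + q ^ Suc k * node_poly q k B"
proof (induction k)
  case (Suc k)
  have "q * divdiff q (Suc (Suc k)) (q * A) (q * B) =
        q * (B - q ^ k) * (q * divdiff q (Suc k) (q * A) (q * B)) + q * node_poly q (Suc k) (q * A)"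
    by (simp add: algebra_simps)
  also have "\<dots> = q ^ Suc k * (q * A - 1) * ((B - q ^ k) * divdiff q k A B + node_poly q k A) +
        q ^ Suc (Suc k) * ((B - q ^ k) * node_poly q k B)"
    unfolding Suc.IH node_poly_scaled by (simp add: algebra_simps)
  finally show ?case by (simp add: node_poly_Suc mult_ac)
qed simp

text \<open>
  The algebraic core of the telescoping. On the left is the discrepancy between
  \<open>A (d_(k+1) - d_k)\<close> and \<open>p_k(B) + p_(k+1)(A)\<close>. The first two terms on the right together vanish for
  \<open>A = 1\<close> and for \<open>B = 1\<close>, and under \<open>A \<mapsto> q A\<close>, \<open>B \<mapsto> q B\<close> they become a multiple of \<open>d_k(A,B)\<close>, which is
  what the last term cancels after summation.
\<close>

lemma divdiff_step:
  "A * (divdiff q (Suc k) A B - divdiff q k A B) - node_poly q k B - node_poly q (Suc k) A =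
   (B - 1) * divdiff q (Suc k) A B - node_poly q (Suc k) B - q ^ k * divdiff q k A B"
  (is "?lhs = ?rhs")
proof -
  have "?lhs - ?rhs =
        ((A - B) * divdiff q (Suc k) A B - (node_poly q (Suc k) A - node_poly q (Suc k) B)) +
        (divdiff q (Suc k) A B - ((A - q ^ k) * divdiff q k A B + node_poly q k B))"
    by (simp add: algebra_simps del: divdiff.simps(2))
  also have "\<dots> = 0"
    by (simp only: divdiff_diff divdiff_Suc'[symmetric] diff_self add_0)
  finally show ?thesis by simp
qed

section \<open>Reciprocals of finite q-factorials\<close>

definition inv_qfact :: "rat fps \<Rightarrow> nat \<Rightarrow> rat fps" where
  "inv_qfact q n = inverse (\<Prod>i<n. 1 - q ^ Suc i)"

lemma inv_qfact_0 [simp]: "inv_qfact q 0 = 1"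
  by (simp add: inv_qfact_def)

lemma inv_qfact_Suc: "inv_qfact q (Suc n) = inv_qfact q n * inverse (1 - q ^ Suc n)"
  by (simp add: inv_qfact_def fps_inverse_mult)

lemma inv_qfact_absorb:
  assumes "fps_nth q 0 = 0"
  shows "inv_qfact q (Suc n) * (1 - q ^ Suc n) = inv_qfact q n"
proof -
  have "inverse (1 - q ^ Suc n) * (1 - q ^ Suc n) = 1"
    by (rule inverse_mult_eq_1) (simp add: assms)
  thus ?thesis by (simp only: inv_qfact_Suc mult.assoc mult_1_right)
qed

text \<open>
  The factors of \<open>p_k(q^(b+k))\<close> are, up to sign and powers of \<open>q\<close>, the top \<open>k\<close> factors of the
  q-factorial of \<open>b + k\<close>.
\<close>

lemma inv_qfact_node_poly:
  assumes "fps_nth q 0 = 0"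
  shows "inv_qfact q (b + k) * node_poly q k (q ^ (b + k)) =
         (-1) ^ k * q ^ (k choose 2) * inv_qfact q b"
proof (induction k)
  case (Suc k)
  have "inv_qfact q (b + Suc k) * node_poly q (Suc k) (q ^ (b + Suc k)) =
        - (q ^ k) * (inv_qfact q (Suc (b + k)) * (1 - q ^ Suc (b + k))) * node_poly q k (q ^ (b + k))"
    unfolding add_Suc_right power_Suc[of q "b + k"] node_poly_scaled by (simp add: algebra_simps)
  also have "\<dots> = - (q ^ k) * (inv_qfact q (b + k) * node_poly q k (q ^ (b + k)))"
    by (simp only: inv_qfact_absorb[OF assms] mult_ac)
  also have "\<dots> = (-1) ^ Suc k * q ^ (Suc k choose 2) * inv_qfact q b"
    unfolding Suc by (simp add: numeral_2_eq_2 power_add algebra_simps)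
  finally show ?case .
qed (simp add: numeral_2_eq_2)

lemma inv_qfact_node_poly_0:
  assumes "fps_nth q 0 = 0"
  shows "inv_qfact q k * node_poly q k (q ^ k) = (-1) ^ k * q ^ (k choose 2)"
  using inv_qfact_node_poly[OF assms, of 0 k] by simp

context
  fixes q :: "rat fps"
  assumes q: "nonneg_coeffs q" "fps_nth q 0 = 0"
begin

lemma nonneg_geometric_q: "nonneg_coeffs (inverse (1 - q ^ Suc n))"
  using q by (intro nonneg_coeffs_geometric nonneg_coeffs_power) simp_all

lemma nonneg_inv_qfact: "nonneg_coeffs (inv_qfact q n)"
  by (induction n)
     (simp_all add: inv_qfact_Suc nonneg_coeffs_intros nonneg_geometric_q del: power_Suc)

lemma nonneg_inv_qfact_node_poly:
  "nonneg_coeffs ((-1) ^ k * inv_qfact q b * node_poly q k (q ^ b))"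
proof (cases "b < k")
  case False
  then obtain c where b: "b = c + k" by (metis add.commute le_Suc_ex not_less)
  have "(-1) ^ k * inv_qfact q b * node_poly q k (q ^ b) = q ^ (k choose 2) * inv_qfact q c"
    unfolding b mult.assoc inv_qfact_node_poly[OF q(2)]
    by (simp add: power_mult_distrib[symmetric] mult.assoc[symmetric])
  thus ?thesis using q by (simp add: nonneg_coeffs_intros nonneg_inv_qfact)
qed (simp add: node_poly_eq_0 nonneg_coeffs_0)

text \<open>
  Equivalently, the q-binomial coefficient of \<open>r + s\<close> over \<open>r\<close> minus 1 has nonnegative
  coefficients after division by \<open>(q;q)_(r+s)\<close>. The induction follows the q-Pascal rule.
\<close>

lemma inv_qfact_superadditive: "nonneg_coeffs (inv_qfact q r * inv_qfact q s - inv_qfact q (r + s))"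
proof (induction r)
  case (Suc r)
  show ?case
  proof (cases s)
    case s: (Suc t)
    let ?n = "Suc (r + s)"
    let ?g = "inverse (1 - q ^ ?n)"
    have "inv_qfact q (Suc r) * inv_qfact q s * (1 - q ^ ?n) =
          inv_qfact q (Suc r) * (1 - q ^ Suc r) * inv_qfact q s +
          q ^ Suc r * inv_qfact q (Suc r) * (inv_qfact q s * (1 - q ^ s))"
      by (simp add: algebra_simps power_add)
    also have "\<dots> = inv_qfact q r * inv_qfact q s + q ^ Suc r * inv_qfact q (Suc r) * inv_qfact q t"
      by (simp only: s inv_qfact_absorb[OF q(2)])
    finally have pascal: "inv_qfact q (Suc r) * inv_qfact q s * (1 - q ^ ?n) = \<dots>" .
    have unit: "(1 - q ^ ?n) * ?g = 1"
      by (rule inverse_mult_eq_1') (simp add: q(2))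
    have "inv_qfact q (Suc r) * inv_qfact q s =
          inv_qfact q (Suc r) * inv_qfact q s * (1 - q ^ ?n) * ?g"
      by (simp only: mult.assoc unit mult_1_right)
    hence "inv_qfact q (Suc r) * inv_qfact q s - inv_qfact q (Suc r + s) =
          ((inv_qfact q r * inv_qfact q s - inv_qfact q (r + s)) +
           q ^ Suc r * inv_qfact q (Suc r) * inv_qfact q t) * ?g"
      unfolding pascal by (simp add: inv_qfact_Suc algebra_simps del: power_Suc)
    thus ?thesis
      using Suc q by (simp add: nonneg_coeffs_intros nonneg_inv_qfact nonneg_geometric_q del: power_Suc)
  qed (simp add: nonneg_coeffs_0)
qed (simp add: nonneg_coeffs_0)

lemma geometric_cancel:
  assumes "j < a"
  shows "inverse (1 - q ^ (a - j)) * (q ^ a - q ^ j) = - (q ^ j)"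
proof -
  define u where "u = inverse (1 - q ^ (a - j))"
  have unit: "u * (1 - q ^ (a - j)) = 1"
    unfolding u_def
    by (rule inverse_mult_eq_1) (use assms q(2) in \<open>simp add: fps_power_zeroth power_0_left\<close>)
  have "q ^ a = q ^ j * q ^ (a - j)" using assms by (simp flip: power_add)
  hence "u * (q ^ a - q ^ j) = u * (q ^ j * q ^ (a - j) - q ^ j)" by (rule arg_cong)
  also have "\<dots> = - (q ^ j * (u * (1 - q ^ (a - j))))" by (simp add: algebra_simps)
  finally have "u * (q ^ a - q ^ j) = - (q ^ j)" by (simp only: unit mult_1_right)
  thus ?thesis by (simp only: u_def)
qed

text \<open>
  Unrolling \<open>divdiff_Suc'\<close> gives a sum over \<open>i < j\<close> of \<open>p_i(q^b)\<close> times the factors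
  \<open>q^a - q^l\<close>, \<open>i < l < j\<close>. Those factors are negative since \<open>l < a\<close>, and each is absorbed by
  \<open>1 / (1 - q^(a-l))\<close>; divided by \<open>(q;q)_b\<close>, \<open>p_i(q^b)\<close> has sign \<open>(-1)^i\<close> or vanishes, whatever the
  size of \<open>b\<close>.
  The induction carries only the denominators with \<open>l < j\<close>, rather than all of
  \<open>1 / (q;q)_a\<close>, because no factor may be absorbed twice.
\<close>

lemma nonneg_divdiff_partial_denominator:
  assumes "j \<le> a"
  shows "nonneg_coeffs (inv_qfact q b * (\<Prod>l<j. inverse (1 - q ^ (a - l))) *
           ((-1) ^ (j + 1) * divdiff q j (q ^ a) (q ^ b)))"
  using assms
proof (induction j)
  case (Suc j)
  define u where "u = inverse (1 - q ^ (a - j))"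
  define g where "g = (\<Prod>l<j. inverse (1 - q ^ (a - l)))"
  obtain m where m: "a - j = Suc m" using Suc.prems by (metis Suc_diff_Suc Suc_le_lessD)
  have u: "nonneg_coeffs u" unfolding u_def m by (rule nonneg_geometric_q)
  have g: "nonneg_coeffs g" unfolding g_def
  proof (rule nonneg_coeffs_prod)
    fix l assume "l < j"
    hence "a - l = Suc (a - Suc l)" using Suc.prems by simp
    thus "nonneg_coeffs (inverse (1 - q ^ (a - l)))" by (simp only: nonneg_geometric_q)
  qed
  have cancel: "u * (q ^ a - q ^ j) = - (q ^ j)"
    unfolding u_def using Suc.prems by (intro geometric_cancel) simp
  have IH: "nonneg_coeffs (inv_qfact q b * g * ((-1) ^ (j + 1) * divdiff q j (q ^ a) (q ^ b)))"
    unfolding g_def using Suc by simp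
  have "inv_qfact q b * (g * u) * ((-1) ^ (Suc j + 1) * divdiff q (Suc j) (q ^ a) (q ^ b)) =
        - (u * (q ^ a - q ^ j)) * (inv_qfact q b * g * ((-1) ^ (j + 1) * divdiff q j (q ^ a) (q ^ b))) +
        g * u * ((-1) ^ j * inv_qfact q b * node_poly q j (q ^ b))"
    unfolding divdiff_Suc' by (simp add: algebra_simps)
  also have "nonneg_coeffs \<dots>"
    unfolding cancel minus_minus
    by (rule nonneg_coeffs_add[OF nonneg_coeffs_mult[OF nonneg_coeffs_power[OF q(1)] IH]
          nonneg_coeffs_mult[OF nonneg_coeffs_mult[OF g u] nonneg_inv_qfact_node_poly]])
  finally show ?case by (simp add: g_def u_def)
qed (simp add: nonneg_coeffs_0)

lemma inv_qfact_split:
  assumes "j \<le> a"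
  shows "inv_qfact q a = inv_qfact q (a - j) * (\<Prod>l<j. inverse (1 - q ^ (a - l)))"
  using assms
proof (induction j)
  case (Suc j)
  then obtain m where m: "a - j = Suc m" by (metis Suc_diff_Suc Suc_le_lessD)
  hence "a - Suc j = m" by simp
  thus ?case using Suc m by (simp add: inv_qfact_Suc mult_ac del: power_Suc)
qed simp

text \<open>
  Keeping only the last summand \<open>p_j(q^b)\<close> of the expansion described above gives a lower bound.
\<close>

lemma nonneg_divdiff_Suc_diff:
  assumes "Suc j \<le> a" and "j \<le> b"
  shows "nonneg_coeffs ((-1) ^ j * (inv_qfact q a * inv_qfact q b * divdiff q (Suc j) (q ^ a) (q ^ b))
           - q ^ (j choose 2) * inv_qfact q a * inv_qfact q (b - j))"
proof -
  define g where "g = (\<Prod>l<j. inverse (1 - q ^ (a - l)))"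
  define u where "u = inverse (1 - q ^ (a - j))"
  have cancel: "u * (q ^ a - q ^ j) = - (q ^ j)"
    unfolding u_def using assms(1) by (intro geometric_cancel) simp
  have split: "inv_qfact q a = inv_qfact q (a - Suc j) * g * u"
    using inv_qfact_split[OF assms(1)] by (simp add: g_def u_def)
  have "inv_qfact q b * node_poly q j (q ^ b) = (-1) ^ j * q ^ (j choose 2) * inv_qfact q (b - j)"
    using inv_qfact_node_poly[OF q(2), of "b - j" j] assms(2) by simp
  hence node: "(-1) ^ j * (inv_qfact q b * node_poly q j (q ^ b)) = q ^ (j choose 2) * inv_qfact q (b - j)"
    by (simp add: mult.assoc[symmetric] power_mult_distrib[symmetric])
  have "(-1) ^ j * (inv_qfact q a * inv_qfact q b * divdiff q (Suc j) (q ^ a) (q ^ b)) =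
        inv_qfact q (a - Suc j) * (- (u * (q ^ a - q ^ j))) *
          (inv_qfact q b * g * ((-1) ^ (j + 1) * divdiff q j (q ^ a) (q ^ b))) +
        inv_qfact q a * ((-1) ^ j * (inv_qfact q b * node_poly q j (q ^ b)))"
    unfolding divdiff_Suc' split by (simp add: algebra_simps)
  hence "(-1) ^ j * (inv_qfact q a * inv_qfact q b * divdiff q (Suc j) (q ^ a) (q ^ b))
           - q ^ (j choose 2) * inv_qfact q a * inv_qfact q (b - j) =
        inv_qfact q (a - Suc j) * q ^ j *
          (inv_qfact q b * g * ((-1) ^ (j + 1) * divdiff q j (q ^ a) (q ^ b)))"
    unfolding cancel minus_minus node by (simp add: mult_ac)
  also have "nonneg_coeffs \<dots>"
  proof (rule nonneg_coeffs_mult)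
    show "nonneg_coeffs (inv_qfact q (a - Suc j) * q ^ j)"
      by (intro nonneg_coeffs_mult nonneg_coeffs_power nonneg_inv_qfact q)
    show "nonneg_coeffs (inv_qfact q b * g * ((-1) ^ (j + 1) * divdiff q j (q ^ a) (q ^ b)))"
      unfolding g_def using assms(1) by (intro nonneg_divdiff_partial_denominator) simp
  qed
  finally show ?thesis .
qed

lemma nonneg_divdiff:
  assumes "k \<le> a"
  shows "nonneg_coeffs ((-1) ^ (k + 1) * (inv_qfact q a * inv_qfact q b * divdiff q k (q ^ a) (q ^ b)))"
proof -
  have "(-1) ^ (k + 1) * (inv_qfact q a * inv_qfact q b * divdiff q k (q ^ a) (q ^ b)) =
        inv_qfact q (a - k) * (inv_qfact q b * (\<Prod>l<k. inverse (1 - q ^ (a - l))) *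
           ((-1) ^ (k + 1) * divdiff q k (q ^ a) (q ^ b)))"
    by (subst inv_qfact_split[OF assms]) (simp add: mult_ac)
  thus ?thesis
    by (simp only: nonneg_coeffs_mult[OF nonneg_inv_qfact nonneg_divdiff_partial_denominator[OF assms]])
qed

text \<open>
  The factor \<open>1 / (1 - q)\<close> turns \<open>1 - q^e\<close> into a polynomial with nonnegative coefficients.
\<close>

lemma nonneg_inv_qfact_diff_power:
  assumes "1 \<le> n"
  shows "nonneg_coeffs (inv_qfact q n - q ^ e * inv_qfact q n)"
proof -
  obtain m where n: "n = Suc m" using assms by (cases n) auto
  have "1 - q ^ e = (\<Sum>i<e. q ^ i) * (1 - q)"
    by (induction e) (simp_all add: algebra_simps)
  hence "(1 - q ^ e) * inverse (1 - q) = (\<Sum>i<e. q ^ i) * ((1 - q) * inverse (1 - q))"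
    by (simp only: mult.assoc)
  also have "(1 - q) * inverse (1 - q) = 1"
    by (rule inverse_mult_eq_1') (simp add: q(2))
  finally have ratio: "(1 - q ^ e) * inverse (1 - q) = (\<Sum>i<e. q ^ i)" by simp
  have "inv_qfact q n = inverse (1 - q) * (\<Prod>i<m. inverse (1 - q ^ Suc (Suc i)))"
    unfolding n by (induction m) (simp_all add: inv_qfact_Suc mult_ac)
  hence "inv_qfact q n - q ^ e * inv_qfact q n =
        ((1 - q ^ e) * inverse (1 - q)) * (\<Prod>i<m. inverse (1 - q ^ Suc (Suc i)))"
    by (simp add: algebra_simps)
  also have "nonneg_coeffs \<dots>"
    unfolding ratio using q
    by (intro nonneg_coeffs_mult nonneg_coeffs_sum nonneg_coeffs_prod nonneg_coeffs_power
              nonneg_geometric_q)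
  finally show ?thesis .
qed

end

section \<open>Euler's expansion\<close>

definition euler_sum :: "rat fps \<Rightarrow> nat \<Rightarrow> rat fps \<Rightarrow> rat fps" where
  "euler_sum q N z = (\<Sum>a\<le>N. z ^ a * inv_qfact q a)"

text \<open>
  Truncated form of the functional equation \<open>(1 - z) E(z) = E(q z)\<close>, which characterises
  \<open>E(z) = 1 / (z; q)_inf\<close>.
\<close>

lemma euler_sum_step:
  assumes "fps_nth q 0 = 0" and "fps_nth z 0 = 0"
  shows "agree_below N (euler_sum q N z * (1 - z)) (euler_sum q N (z * q))"
proof -
  have extend: "agree_below N (euler_sum q (Suc N) t) (euler_sum q N t)" if "fps_nth t 0 = 0" for t
    using agree_below_add[OF agree_below_refl
        agree_below_0_power[OF that, of N "Suc N" "inv_qfact q (Suc N)"]]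
    by (simp add: euler_sum_def)
  have "(z * q) ^ Suc a * inv_qfact q (Suc a) = z ^ Suc a * inv_qfact q (Suc a) - z * (z ^ a * inv_qfact q a)"
    for a
    by (subst (2) inv_qfact_absorb[OF assms(1), symmetric])
       (simp add: power_mult_distrib algebra_simps)
  hence "euler_sum q (Suc N) (z * q) = euler_sum q (Suc N) z - z * euler_sum q N z"
    unfolding euler_sum_def sum.atMost_Suc_shift
    by (simp add: sum_subtractf sum_distrib_left del: power_Suc)
  hence "agree_below N (euler_sum q (Suc N) (z * q)) (euler_sum q N z - z * euler_sum q N z)"
    using agree_below_diff[OF extend[OF assms(2)] agree_below_refl] by simp
  moreover have "agree_below N (euler_sum q (Suc N) (z * q)) (euler_sum q N (z * q))"
    by (rule extend) (simp add: assms)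
  ultimately have "agree_below N (euler_sum q N z - z * euler_sum q N z) (euler_sum q N (z * q))"
    by (blast intro: agree_below_sym agree_below_trans)
  thus ?thesis by (simp add: algebra_simps)
qed

lemma euler_sum_qpochhammer_inf:
  assumes "fps_nth q 0 = 0" and "fps_nth z 0 = 0"
  shows "agree_below N (euler_sum q N z * qpochhammer_inf z q) 1"
proof -
  have partial: "agree_below N (euler_sum q N z * (\<Prod>n<M. 1 - z * q ^ n)) (euler_sum q N (z * q ^ M))"
    for M
  proof (induction M)
    case (Suc M)
    have "agree_below N (euler_sum q N z * (\<Prod>n<M. 1 - z * q ^ n) * (1 - z * q ^ M))
                        (euler_sum q N (z * q ^ M) * (1 - z * q ^ M))"
      by (intro agree_below_mult Suc agree_below_refl)
    also have "agree_below N \<dots> (euler_sum q N (z * q ^ M * q))"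
      by (rule euler_sum_step) (simp_all add: assms)
    finally show ?case by (simp add: mult_ac)
  qed (simp add: agree_below_refl)
  have far: "agree_below N (euler_sum q N (z * q ^ M)) 1" if "N \<le> M" for M
  proof -
    have "agree_below N ((z * q ^ M) ^ a * inv_qfact q a) (if a = 0 then 1 else 0)" for a
    proof (cases a)
      case (Suc d)
      have *: "(z * q ^ M) ^ a * inv_qfact q a = q ^ M * (z * (z * q ^ M) ^ d * inv_qfact q a)"
        by (simp add: Suc mult_ac)
      have "agree_below N ((z * q ^ M) ^ a * inv_qfact q a) 0"
        unfolding * by (rule agree_below_0_power[OF assms(1) that])
      thus ?thesis using Suc by simp
    qed (simp add: agree_below_refl)
    hence "agree_below N (euler_sum q N (z * q ^ M)) (\<Sum>a\<le>N. if a = 0 then 1 else 0)"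
      unfolding euler_sum_def by (intro agree_below_sum)
    thus ?thesis by simp
  qed
  have "(\<lambda>M. \<Prod>n\<le>M. 1 - z * q ^ n) \<longlonglongrightarrow> qpochhammer_inf z q"
    using has_prod_qpochhammer_inf[OF assms(2,1)]
    by (auto simp: has_prod_def raw_has_prod_def)
  hence "\<forall>\<^sub>F M in sequentially. \<forall>n\<in>{..<N}.
           fps_nth (\<Prod>n\<le>M. 1 - z * q ^ n) n = fps_nth (qpochhammer_inf z q) n"
    by (intro eventually_ball_finite) (auto simp: tendsto_fps_iff)
  then obtain M0 where "\<forall>M\<ge>M0. agree_below N (\<Prod>n\<le>M. 1 - z * q ^ n) (qpochhammer_inf z q)"
    by (auto simp: eventually_sequentially agree_below_def)
  hence "agree_below N (qpochhammer_inf z q) (\<Prod>n<Suc (max M0 N). 1 - z * q ^ n)"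
    unfolding lessThan_Suc_atMost by (simp add: agree_below_sym)
  hence "agree_below N (euler_sum q N z * qpochhammer_inf z q)
                       (euler_sum q N z * (\<Prod>n<Suc (max M0 N). 1 - z * q ^ n))"
    by (intro agree_below_mult agree_below_refl)
  also note partial
  also have "agree_below N (euler_sum q N (z * q ^ Suc (max M0 N))) 1"
    by (rule far) simp
  finally show ?thesis .
qed

text \<open>
  Weighting the terms of Euler's series by \<open>p_k(q^b)\<close> kills those with \<open>b < k\<close> and shifts
  the others, so it multiplies the series by a monomial. Both halves of a theta term arise this way.
\<close>

lemma euler_sum_node_poly:
  assumes "fps_nth q 0 = 0" and "fps_nth z 0 = 0"
  shows "agree_below N (\<Sum>b\<le>N. z ^ b * inv_qfact q b * node_poly q k (q ^ b))
                       ((-1) ^ k * q ^ (k choose 2) * z ^ k * euler_sum q N z)"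
proof -
  let ?f = "\<lambda>b. z ^ b * inv_qfact q b * node_poly q k (q ^ b)"
  have "agree_below N (\<Sum>b<Suc N. ?f b) (\<Sum>b<Suc N + m. ?f b)" for m
  proof (induction m)
    case (Suc m)
    have "agree_below N (?f (Suc N + m)) 0"
      unfolding mult.assoc by (rule agree_below_0_power[OF assms(2)]) simp
    from agree_below_add[OF Suc agree_below_sym[OF this]] show ?case by simp
  qed (simp add: agree_below_refl)
  hence "agree_below N (\<Sum>b\<le>N. ?f b) (\<Sum>b<Suc N + k. ?f b)"
    by (simp add: lessThan_Suc_atMost)
  also have "(\<Sum>b<Suc N + k. ?f b) = (\<Sum>b<k. ?f b) + (\<Sum>b\<le>N. ?f (b + k))"
    by (induction N) (simp_all add: add.commute)
  also have "(\<Sum>b<k. ?f b) = 0" by (simp add: node_poly_eq_0)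
  also have "(\<Sum>b\<le>N. ?f (b + k)) = (-1) ^ k * q ^ (k choose 2) * z ^ k * euler_sum q N z"
    unfolding euler_sum_def sum_distrib_left mult.assoc inv_qfact_node_poly[OF assms(1)]
    by (simp add: power_add mult_ac)
  finally show ?thesis by simp
qed

section \<open>Triangular numbers\<close>

lemma double_choose_two: "2 * (Suc n choose 2) = n * Suc n"
  by (induction n) (simp_all add: numeral_2_eq_2)

lemma triangular_le:
  "2 * (j + Suc i) + (j choose 2) \<le> Suc (j + Suc i + Suc i) choose 2"
proof -
  have "2 * (j choose 2) + j = j * j"
    by (cases j) (simp_all add: double_choose_two)
  moreover have "2 * (Suc (j + Suc i + Suc i) choose 2) = (j + Suc i + Suc i) * Suc (j + Suc i + Suc i)"
    by (rule double_choose_two)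
  ultimately have "2 * (2 * (j + Suc i) + (j choose 2)) \<le> 2 * (Suc (j + Suc i + Suc i) choose 2)"
    by (simp add: algebra_simps)
  thus ?thesis by simp
qed

section \<open>The truncated double series\<close>

locale triple_product_variables =
  fixes x y q :: "rat fps"
  assumes q_def: "q = x * y"
    and x: "nonneg_coeffs x" "fps_nth x 0 = 0" "x \<noteq> 0"
    and y: "nonneg_coeffs y" "fps_nth y 0 = 0" "y \<noteq> 0"
begin

lemma q: "nonneg_coeffs q" "fps_nth q 0 = 0" "q \<noteq> 0"
  using x y by (simp_all add: q_def nonneg_coeffs_mult)

definition weight :: "nat \<Rightarrow> nat \<Rightarrow> rat fps" where
  "weight a b = x ^ a * y ^ b * (inv_qfact q a * inv_qfact q b)"

lemma weight_diagonal: "weight r r = q ^ r * (inv_qfact q r * inv_qfact q r)"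
proof -
  have "q ^ r = x ^ r * y ^ r" by (simp only: q_def power_mult_distrib)
  thus ?thesis by (simp only: weight_def)
qed

definition power_divdiff :: "nat \<Rightarrow> nat \<Rightarrow> nat \<Rightarrow> rat fps" where
  "power_divdiff k a b = divdiff q k (q ^ a) (q ^ b)"

text \<open>
  The part of the discrepancy in \<open>divdiff_step\<close> that the point \<open>(a, b)\<close> receives from
  \<open>(a - 1, b - 1)\<close>.
\<close>

definition flow :: "nat \<Rightarrow> nat \<Rightarrow> nat \<Rightarrow> rat fps" where
  "flow k a b = weight a b * ((q ^ b - 1) * power_divdiff (Suc k) a b - node_poly q (Suc k) (q ^ b))"

lemma flow_0_left: "flow k 0 b = 0"
  using divdiff_diff[of 1 "q ^ b" q "Suc k"] node_poly_eq_0[of 0 "Suc k" q]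
  by (simp add: flow_def power_divdiff_def algebra_simps del: divdiff.simps(2))

lemma flow_0_right: "flow k a 0 = 0"
  using node_poly_eq_0[of 0 "Suc k" q] by (simp add: flow_def)

text \<open>
  In \<open>w(a+1,b+1)\<close> the q-factorials absorb \<open>(1 - q^(a+1)) (1 - q^(b+1))\<close> and leave
  \<open>x y\<close> times \<open>w(a,b)\<close>. That \<open>x y\<close> is the base \<open>q\<close> makes this match the power of \<open>q\<close> in
  \<open>divdiff_scaled\<close>.
\<close>

lemma flow_Suc: "flow k (Suc a) (Suc b) = q ^ k * (weight a b * power_divdiff k a b)"
proof -
  have weight: "weight (Suc a) (Suc b) * ((1 - q ^ Suc a) * (1 - q ^ Suc b)) = q * weight a b"
  proof -
    have xy: "x ^ Suc a * y ^ Suc b = q * (x ^ a * y ^ b)"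
      by (simp add: q_def mult_ac)
    have "weight (Suc a) (Suc b) * ((1 - q ^ Suc a) * (1 - q ^ Suc b)) =
          (x ^ Suc a * y ^ Suc b) * ((inv_qfact q (Suc a) * (1 - q ^ Suc a)) *
                                     (inv_qfact q (Suc b) * (1 - q ^ Suc b)))"
      by (simp only: weight_def mult_ac)
    thus ?thesis by (simp only: xy inv_qfact_absorb[OF q(2)] weight_def mult_ac)
  qed
  have "q * ((q ^ Suc b - 1) * power_divdiff (Suc k) (Suc a) (Suc b) - node_poly q (Suc k) (q ^ Suc b)) =
        (q ^ Suc b - 1) * (q * divdiff q (Suc k) (q * q ^ a) (q * q ^ b)) -
          q * node_poly q (Suc k) (q * q ^ b)"
    by (simp add: power_divdiff_def algebra_simps del: divdiff.simps(2))
  also have "\<dots> = (1 - q ^ Suc a) * (1 - q ^ Suc b) * (q ^ k * power_divdiff k a b)"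
    unfolding divdiff_scaled node_poly_scaled by (simp add: power_divdiff_def algebra_simps)
  finally have "q * flow k (Suc a) (Suc b) =
      weight (Suc a) (Suc b) * ((1 - q ^ Suc a) * (1 - q ^ Suc b)) * (q ^ k * power_divdiff k a b)"
    by (simp add: flow_def mult_ac)
  also have "\<dots> = q * (q ^ k * (weight a b * power_divdiff k a b))"
    unfolding weight by (simp add: mult_ac)
  finally show ?thesis using q(3) by simp
qed

lemma weight_divdiff_step:
  "weight a b * (q ^ a * power_divdiff (Suc k) a b) - weight a b * (q ^ a * power_divdiff k a b) =
   weight a b * node_poly q k (q ^ b) + weight a b * node_poly q (Suc k) (q ^ a) +
   (flow k a b - q ^ k * (weight a b * power_divdiff k a b))"
proof -
  have "q ^ a * (power_divdiff (Suc k) a b - power_divdiff k a b) =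
        node_poly q k (q ^ b) + node_poly q (Suc k) (q ^ a) +
        ((q ^ b - 1) * power_divdiff (Suc k) a b - node_poly q (Suc k) (q ^ b) - q ^ k * power_divdiff k a b)"
    unfolding power_divdiff_def divdiff_step[symmetric] by simp
  hence "weight a b * (q ^ a * (power_divdiff (Suc k) a b - power_divdiff k a b)) =
        weight a b * (node_poly q k (q ^ b) + node_poly q (Suc k) (q ^ a) +
        ((q ^ b - 1) * power_divdiff (Suc k) a b - node_poly q (Suc k) (q ^ b) - q ^ k * power_divdiff k a b))"
    by simp
  thus ?thesis by (simp add: flow_def algebra_simps)
qed

definition theta_term :: "nat \<Rightarrow> rat fps" where
  "theta_term k = q ^ (k choose 2) * y ^ k - q ^ (Suc k choose 2) * x ^ Suc k"

definition square_sum :: "nat \<Rightarrow> nat \<Rightarrow> rat fps" where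
  "square_sum N k = (\<Sum>a\<le>N. \<Sum>b\<le>N. weight a b * (q ^ a * power_divdiff k a b))"

text \<open>
  What flows out of the square through its far edges has order at least \<open>N\<close>, and nothing flows in.
\<close>

lemma agree_below_flow:
  "agree_below N (\<Sum>a\<le>N. \<Sum>b\<le>N. q ^ k * (weight a b * power_divdiff k a b)) (\<Sum>a\<le>N. \<Sum>b\<le>N. flow k a b)"
proof -
  let ?g = "\<lambda>a b. q ^ k * (weight a b * power_divdiff k a b)"
  have "agree_below N (\<Sum>a\<le>N. \<Sum>b\<le>N. ?g a b) (\<Sum>a<N. \<Sum>b<N. ?g a b)"
  proof (rule agree_below_square)
    fix i
    have *: "?g i N = y ^ N * (q ^ k * x ^ i * inv_qfact q i * inv_qfact q N * power_divdiff k i N)"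
      "?g N i = x ^ N * (q ^ k * y ^ i * inv_qfact q i * inv_qfact q N * power_divdiff k N i)"
      by (simp_all add: weight_def mult_ac)
    show "agree_below N (?g i N) 0" and "agree_below N (?g N i) 0"
      unfolding * by (rule agree_below_0_power; simp add: x y)+
  qed
  also have "(\<Sum>a<N. \<Sum>b<N. ?g a b) = (\<Sum>a\<le>N. \<Sum>b\<le>N. flow k a b)"
    by (simp add: sum.atMost_shift flow_0_left flow_0_right flow_Suc)
  finally show ?thesis .
qed

lemma square_sum_step:
  "agree_below N (square_sum N (Suc k) - square_sum N k)
     ((-1) ^ k * theta_term k * (euler_sum q N x * euler_sum q N y))"
proof -
  let ?g = "\<Sum>a\<le>N. \<Sum>b\<le>N. q ^ k * (weight a b * power_divdiff k a b)"
  let ?F = "\<Sum>a\<le>N. \<Sum>b\<le>N. flow k a b"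
  let ?P = "(\<Sum>a\<le>N. \<Sum>b\<le>N. weight a b * node_poly q k (q ^ b)) +
            (\<Sum>a\<le>N. \<Sum>b\<le>N. weight a b * node_poly q (Suc k) (q ^ a))"
  have entries:
    "(\<Sum>a\<le>N. \<Sum>b\<le>N. weight a b * node_poly q k (q ^ b)) =
     euler_sum q N x * (\<Sum>b\<le>N. y ^ b * inv_qfact q b * node_poly q k (q ^ b))"
    "(\<Sum>a\<le>N. \<Sum>b\<le>N. weight a b * node_poly q (Suc k) (q ^ a)) =
     (\<Sum>a\<le>N. x ^ a * inv_qfact q a * node_poly q (Suc k) (q ^ a)) * euler_sum q N y"
    unfolding euler_sum_def sum_product weight_def by (simp_all only: mult_ac)
  have difference: "square_sum N (Suc k) - square_sum N k = ?P + (?F - ?g)"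
    unfolding square_sum_def sum_subtractf[symmetric] weight_divdiff_step
    by (simp only: sum.distrib sum_subtractf)
  have balance: "agree_below N (?P + (?F - ?g)) (?P + (?F - ?F))"
    by (intro agree_below_add agree_below_diff agree_below_refl agree_below_flow)
  have "agree_below N
      (euler_sum q N x * (\<Sum>b\<le>N. y ^ b * inv_qfact q b * node_poly q k (q ^ b)) +
       (\<Sum>a\<le>N. x ^ a * inv_qfact q a * node_poly q (Suc k) (q ^ a)) * euler_sum q N y)
      (euler_sum q N x * ((-1) ^ k * q ^ (k choose 2) * y ^ k * euler_sum q N y) +
       ((-1) ^ Suc k * q ^ (Suc k choose 2) * x ^ Suc k * euler_sum q N x) * euler_sum q N y)"
    by (intro agree_below_add agree_below_mult agree_below_refl euler_sum_node_poly q x y)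
  hence "agree_below N ?P
      (euler_sum q N x * ((-1) ^ k * q ^ (k choose 2) * y ^ k * euler_sum q N y) +
       ((-1) ^ Suc k * q ^ (Suc k choose 2) * x ^ Suc k * euler_sum q N x) * euler_sum q N y)"
    by (simp only: entries)
  moreover have "euler_sum q N x * ((-1) ^ k * q ^ (k choose 2) * y ^ k * euler_sum q N y) +
       ((-1) ^ Suc k * q ^ (Suc k choose 2) * x ^ Suc k * euler_sum q N x) * euler_sum q N y =
     (-1) ^ k * theta_term k * (euler_sum q N x * euler_sum q N y)"
    by (simp add: theta_term_def algebra_simps)
  ultimately have "agree_below N ?P ((-1) ^ k * theta_term k * (euler_sum q N x * euler_sum q N y))"
    by (simp only:)
  with balance show ?thesis
    unfolding difference diff_self add_0_right by (rule agree_below_trans)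
qed

lemma square_sum_telescope:
  "agree_below N (square_sum N (k + m) - square_sum N k)
     ((\<Sum>i<m. (-1) ^ (k + i) * theta_term (k + i)) * (euler_sum q N x * euler_sum q N y))"
proof (induction m)
  case (Suc m)
  from agree_below_add[OF Suc square_sum_step[of N "k + m"]] show ?case
    by (simp add: distrib_right)
qed (simp add: agree_below_refl)

definition diagonal_term :: "nat \<Rightarrow> nat \<Rightarrow> rat fps" where
  "diagonal_term k r = weight r r * (q ^ r * power_divdiff k r r)"

text \<open>
  The same telescoping on the diagonal, where the sum stops at \<open>r = k\<close>. What this
  last point would pass on to the next one is exactly the entry \<open>r = k\<close> for \<open>d_k\<close>, which the sum over
  \<open>r < k\<close> lacks; so only the contribution of \<open>p_k\<close> at \<open>q^k\<close> survives.
\<close>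

lemma diagonal_sum_step:
  "(\<Sum>r<Suc k. diagonal_term (Suc k) r) - (\<Sum>r<k. diagonal_term k r) =
   (-1) ^ k * q ^ (Suc k choose 2) * inv_qfact q k"
proof -
  let ?g = "\<lambda>r. q ^ k * (weight r r * power_divdiff k r r)"
  have "(\<Sum>r<Suc k. diagonal_term (Suc k) r - diagonal_term k r) =
        (\<Sum>r<Suc k. weight r r * node_poly q k (q ^ r)) +
        (\<Sum>r<Suc k. weight r r * node_poly q (Suc k) (q ^ r)) +
        ((\<Sum>r<Suc k. flow k r r) - (\<Sum>r<Suc k. ?g r))"
    unfolding diagonal_term_def weight_divdiff_step by (simp only: sum.distrib sum_subtractf)
  also have "(\<Sum>r<Suc k. weight r r * node_poly q k (q ^ r)) = weight k k * node_poly q k (q ^ k)"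
    by (simp add: node_poly_eq_0)
  also have "(\<Sum>r<Suc k. weight r r * node_poly q (Suc k) (q ^ r)) = 0"
    by (intro sum.neutral) (auto simp: node_poly_eq_0)
  also have "(\<Sum>r<Suc k. flow k r r) = (\<Sum>r<k. ?g r)"
    by (simp only: sum.lessThan_Suc_shift flow_0_left flow_Suc add_0)
  finally have "(\<Sum>r<Suc k. diagonal_term (Suc k) r) - (\<Sum>r<k. diagonal_term k r) =
      weight k k * node_poly q k (q ^ k)"
    by (simp add: sum_subtractf diagonal_term_def algebra_simps)
  also have "\<dots> = q ^ k * inv_qfact q k * (inv_qfact q k * node_poly q k (q ^ k))"
    by (simp add: weight_diagonal mult_ac)
  also have "\<dots> = (-1) ^ k * q ^ (Suc k choose 2) * inv_qfact q k"
    unfolding inv_qfact_node_poly_0[OF q(2)] by (simp add: numeral_2_eq_2 power_add mult_ac)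
  finally show ?thesis .
qed

lemma diagonal_sum_telescope:
  "(\<Sum>r<k + m. diagonal_term (k + m) r) - (\<Sum>r<k. diagonal_term k r) =
   (\<Sum>i<m. (-1) ^ (k + i) * (q ^ (Suc (k + i) choose 2) * inv_qfact q (k + i)))"
proof (induction m)
  case (Suc m)
  thus ?case using diagonal_sum_step[of "k + m"] by (simp add: mult.assoc algebra_simps)
qed simp

definition off_diagonal :: "nat \<Rightarrow> nat \<Rightarrow> rat fps" where
  "off_diagonal N k = (\<Sum>a\<le>N. \<Sum>b\<le>N. if a = b then 0 else weight a b * (q ^ a * power_divdiff k a b))"

lemma square_sum_split:
  "square_sum N k = (\<Sum>r\<le>N. diagonal_term k r) + off_diagonal N k"
proof -
  have "square_sum N k = (\<Sum>a\<le>N. \<Sum>b\<le>N.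
      (if a = b then diagonal_term k a else 0) +
      (if a = b then 0 else weight a b * (q ^ a * power_divdiff k a b)))"
    unfolding square_sum_def by (intro sum.cong refl) (auto simp: diagonal_term_def)
  also have "\<dots> = (\<Sum>a\<le>N. \<Sum>b\<le>N. if a = b then diagonal_term k a else 0) + off_diagonal N k"
    by (simp only: sum.distrib off_diagonal_def)
  also have "(\<Sum>a\<le>N. \<Sum>b\<le>N. if a = b then diagonal_term k a else 0) = (\<Sum>r\<le>N. diagonal_term k r)"
    by simp
  finally show ?thesis .
qed

lemma power_divdiff_eq_0:
  assumes "a < k" and "b < k" and "a \<noteq> b"
  shows "power_divdiff k a b = 0"
proof -
  have "subdegree q \<noteq> 0" using q by (simp add: subdegree_eq_0_iff)
  hence "q ^ a \<noteq> q ^ b" using assms(3) by (metis mult_right_cancel subdegree_power)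
  moreover have "(q ^ a - q ^ b) * power_divdiff k a b = 0"
    unfolding power_divdiff_def divdiff_diff using assms by (simp add: node_poly_eq_0)
  ultimately show ?thesis by simp
qed

lemma off_diagonal_beyond_square: "off_diagonal N (Suc N) = 0"
  unfolding off_diagonal_def by (intro sum.neutral ballI) (auto simp: power_divdiff_eq_0)

text \<open>
  Of \<open>a\<close> and \<open>b\<close> at least one is \<open>\<ge> k\<close> where the divided difference is nonzero; by symmetry of the
  divided difference it may be put first.
\<close>

lemma nonneg_off_diagonal: "nonneg_coeffs ((-1) ^ (k + 1) * off_diagonal N k)"
proof -
  have term_nonneg: "nonneg_coeffs ((-1) ^ (k + 1) * (weight a b * (q ^ a * power_divdiff k a b)))" if "a \<noteq> b" for a b
  proof (cases "a < k \<and> b < k")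
    case False
    have "nonneg_coeffs ((-1) ^ (k + 1) * (inv_qfact q a * inv_qfact q b * power_divdiff k a b))"
    proof (cases "k \<le> a")
      case True
      thus ?thesis unfolding power_divdiff_def by (rule nonneg_divdiff[OF q(1,2)])
    next
      case k: False
      with False have "k \<le> b" by simp
      from nonneg_divdiff[OF q(1,2) this, of a] show ?thesis
        by (simp add: power_divdiff_def divdiff_commute[of q k "q ^ a"] mult_ac)
    qed
    from nonneg_coeffs_mult[OF _ this, of "x ^ a * y ^ b * q ^ a"] show ?thesis
      using x y q by (simp add: weight_def nonneg_coeffs_intros mult_ac)
  qed (use that in \<open>simp add: power_divdiff_eq_0 nonneg_coeffs_0\<close>)
  have "(-1) ^ (k + 1) * off_diagonal N k = (\<Sum>a\<le>N. \<Sum>b\<le>N.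
      if a = b then 0 else (-1) ^ (k + 1) * (weight a b * (q ^ a * power_divdiff k a b)))"
    unfolding off_diagonal_def sum_distrib_left by (intro sum.cong refl) auto
  also have "nonneg_coeffs \<dots>"
    by (intro nonneg_coeffs_sum) (use term_nonneg nonneg_coeffs_0 in auto)
  finally show ?thesis .
qed

lemma diagonal_term_nonneg:
  assumes "k \<le> r"
  shows "nonneg_coeffs ((-1) ^ (k + 1) * diagonal_term k r)"
proof -
  have "(-1) ^ (k + 1) * diagonal_term k r =
      q ^ r * q ^ r * ((-1) ^ (k + 1) * (inv_qfact q r * inv_qfact q r * power_divdiff k r r))"
    by (simp add: diagonal_term_def weight_diagonal mult_ac)
  also have "nonneg_coeffs \<dots>"
    unfolding power_divdiff_def using q by (intro nonneg_coeffs_mult nonneg_coeffs_power nonneg_divdiff assms)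
  finally show ?thesis .
qed

text \<open>
  With \<open>r = k + i\<close> and \<open>s = i + 1\<close> the chain of lower bounds is
  \<open>h / ((q;q)_r (q;q)_s)\<close>, \<open>h / (q;q)_(r+s)\<close>, \<open>h q^e / (q;q)_(r+s)\<close>, where \<open>h\<close> is the power of \<open>q\<close> with
  exponent \<open>2 r + (k-1 choose 2)\<close> that the diagonal term supplies and \<open>e \<ge> 0\<close> makes up the
  difference to the exponent \<open>r+s+1 choose 2\<close>.
\<close>

lemma diagonal_term_dominates:
  assumes "1 \<le> k"
  shows "nonneg_coeffs ((-1) ^ (k + 1) * diagonal_term k (k + i) -
           q ^ (Suc (k + 2 * i + 1) choose 2) * inv_qfact q (k + 2 * i + 1))"
proof -
  obtain j where k: "k = Suc j" using assms by (cases k) auto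
  define r where "r = j + Suc i"
  define n where "n = r + Suc i"
  have kr: "k + i = r" "k + 2 * i + 1 = n" "r - j = Suc i" by (simp_all add: k r_def n_def)
  have exp: "2 * r + (j choose 2) \<le> Suc n choose 2"
    using triangular_le[of j i] by (simp add: r_def n_def)
  define e where "e = (Suc n choose 2) - (2 * r + (j choose 2))"
  define h where "h = q ^ r * q ^ r * q ^ (j choose 2)"
  have h: "q ^ (Suc n choose 2) = h * q ^ e"
    using exp by (simp add: h_def e_def flip: power_add)
  have nonneg_h: "nonneg_coeffs h" using q by (simp add: h_def nonneg_coeffs_intros)
  have "(-1) ^ (k + 1) * diagonal_term k r - h * (inv_qfact q r * inv_qfact q (Suc i)) =
      q ^ r * q ^ r * ((-1) ^ j * (inv_qfact q r * inv_qfact q r * divdiff q (Suc j) (q ^ r) (q ^ r))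
        - q ^ (j choose 2) * inv_qfact q r * inv_qfact q (r - j))"
    unfolding kr(3) by (simp add: k h_def diagonal_term_def power_divdiff_def weight_diagonal
        right_diff_distrib mult_ac del: divdiff.simps(2))
  also have "nonneg_coeffs \<dots>"
    using q by (intro nonneg_coeffs_mult nonneg_coeffs_power nonneg_divdiff_Suc_diff)
               (simp_all add: r_def)
  finally have "nonneg_coeffs ((-1) ^ (k + 1) * diagonal_term k r - h * (inv_qfact q r * inv_qfact q (Suc i)))" .
  moreover have "nonneg_coeffs (h * (inv_qfact q r * inv_qfact q (Suc i)) - h * inv_qfact q n)"
    unfolding right_diff_distrib[symmetric] n_def
    by (intro nonneg_coeffs_mult nonneg_h inv_qfact_superadditive q)
  moreover have "nonneg_coeffs (h * inv_qfact q n - h * (q ^ e * inv_qfact q n))"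
    unfolding right_diff_distrib[symmetric] n_def
    by (intro nonneg_coeffs_mult nonneg_h nonneg_inv_qfact_diff_power q) simp
  ultimately have "nonneg_coeffs ((-1) ^ (k + 1) * diagonal_term k r - h * (q ^ e * inv_qfact q n))"
    by (blast intro: nonneg_coeffs_trans)
  thus ?thesis unfolding kr h by (simp only: mult.assoc)
qed

text \<open>
  Passing from \<open>M\<close> to \<open>M + 1\<close> adds one negative term, which the diagonal term with index \<open>k + M\<close>
  dominates, and one positive term. The alternating sum therefore ends with a positive term.
\<close>

lemma nonneg_alternating_plus_diagonal:
  assumes "1 \<le> k"
  shows "nonneg_coeffs
    ((\<Sum>i<2 * M + 1. (-1) ^ i * (q ^ (Suc (k + i) choose 2) * inv_qfact q (k + i))) +
     (\<Sum>i<2 * M + 1. (-1) ^ (k + 1) * diagonal_term k (k + i)))"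
proof -
  let ?d = "\<lambda>i. q ^ (Suc (k + i) choose 2) * inv_qfact q (k + i)"
  let ?e = "\<lambda>i. (-1) ^ (k + 1) * diagonal_term k (k + i)"
  have d: "nonneg_coeffs (?d i)" for i
    using q by (intro nonneg_coeffs_mult nonneg_coeffs_power nonneg_inv_qfact)
  have main: "nonneg_coeffs ((\<Sum>i<2 * M + 1. (-1) ^ i * ?d i) + (\<Sum>i<M. ?e i))"
  proof (induction M)
    case (Suc M)
    have "(\<Sum>i<2 * Suc M + 1. (-1) ^ i * ?d i) + (\<Sum>i<Suc M. ?e i) =
        ((\<Sum>i<2 * M + 1. (-1) ^ i * ?d i) + (\<Sum>i<M. ?e i)) + (?e M - ?d (2 * M + 1)) + ?d (2 * M + 2)"
      by simp
    also have "nonneg_coeffs \<dots>"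
      using nonneg_coeffs_add[OF nonneg_coeffs_add[OF Suc diagonal_term_dominates[OF assms, of M]]
          d[of "2 * M + 2"]]
      by (simp only: add.assoc)
    finally show ?case .
  qed (use d[of 0] in simp)
  have "(\<Sum>i<2 * M + 1. ?e i) = (\<Sum>i<M. ?e i) + (\<Sum>i\<in>{M..<2 * M + 1}. ?e i)"
    unfolding lessThan_atLeast0 by (rule sum.atLeastLessThan_concat[symmetric]) simp_all
  moreover have "nonneg_coeffs (\<Sum>i\<in>{M..<2 * M + 1}. ?e i)"
    by (intro nonneg_coeffs_sum diagonal_term_nonneg) simp
  ultimately show ?thesis
    using nonneg_coeffs_add[OF main] by (simp only: add.assoc)
qed

text \<open>
  The tail telescopes to the difference of the square sums for \<open>N + 1\<close> and \<open>k\<close>. In the first one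
  only the diagonal is left, because the square \<open>a, b \<le> N\<close> lies below \<open>N + 1\<close>; subtracting the diagonal
  entries of the second one with \<open>r < k\<close> gives the alternating sum.
\<close>

lemma nonneg_truncated_theta:
  assumes "1 \<le> k"
  obtains f where "nonneg_coeffs f"
    and "agree_below (k + 2 * M) ((\<Sum>i<2 * M + 1. (-1) ^ i * theta_term (k + i)) *
           (euler_sum q (k + 2 * M) x * euler_sum q (k + 2 * M) y)) f"
proof
  define N where "N = k + 2 * M"
  define m where "m = 2 * M + 1"
  have Nm: "Suc N = k + m" by (simp add: N_def m_def)
  let ?s = "(-1) ^ k :: rat fps"
  let ?tail = "\<Sum>i<m. (-1) ^ (k + i) * (q ^ (Suc (k + i) choose 2) * inv_qfact q (k + i))"
  let ?diag = "\<Sum>i<m. diagonal_term k (k + i)"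
  let ?f = "?s * (?tail - ?diag - off_diagonal N k)"
  have sign: "?s * ?s = 1" by (simp flip: power_mult_distrib)
  have split: "(\<Sum>r<k + m. diagonal_term k r) = (\<Sum>r<k. diagonal_term k r) + ?diag"
    by (induction m) simp_all
  have outer: "off_diagonal N (k + m) = 0"
    using off_diagonal_beyond_square[of N] by (simp only: Nm)
  have "square_sum N (Suc N) - square_sum N k = ?tail - ?diag - off_diagonal N k"
    unfolding square_sum_split lessThan_Suc_atMost[symmetric] Nm split outer
    using diagonal_sum_telescope[of k m] by (simp add: algebra_simps)
  hence "agree_below N ((\<Sum>i<m. (-1) ^ (k + i) * theta_term (k + i)) * (euler_sum q N x * euler_sum q N y))
      (?tail - ?diag - off_diagonal N k)"
    using agree_below_sym[OF square_sum_telescope[of N k m]] by (simp add: Nm)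
  from agree_below_mult[OF agree_below_refl[of N ?s] this]
  have "agree_below N (?s * ((\<Sum>i<m. (-1) ^ (k + i) * theta_term (k + i)) *
           (euler_sum q N x * euler_sum q N y))) ?f" .
  also have "?s * ((\<Sum>i<m. (-1) ^ (k + i) * theta_term (k + i)) * (euler_sum q N x * euler_sum q N y)) =
      (\<Sum>i<m. (-1) ^ i * theta_term (k + i)) * (euler_sum q N x * euler_sum q N y)"
    by (simp add: sum_distrib_left power_add sign mult.assoc[symmetric])
  finally show "agree_below (k + 2 * M) ((\<Sum>i<2 * M + 1. (-1) ^ i * theta_term (k + i)) *
           (euler_sum q (k + 2 * M) x * euler_sum q (k + 2 * M) y)) ?f"
    unfolding N_def m_def .
  have "?f = ((\<Sum>i<m. (-1) ^ i * (q ^ (Suc (k + i) choose 2) * inv_qfact q (k + i))) +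
      (\<Sum>i<m. (-1) ^ (k + 1) * diagonal_term k (k + i))) + (-1) ^ (k + 1) * off_diagonal N k"
    by (simp add: sum_distrib_left right_diff_distrib power_add sign mult.assoc[symmetric] sum_negf)
  also have "nonneg_coeffs \<dots>"
    unfolding m_def
    by (intro nonneg_coeffs_add[OF _ nonneg_off_diagonal] nonneg_alternating_plus_diagonal assms)
  finally show "nonneg_coeffs ?f" .
qed

lemma agree_below_0_theta_term:
  assumes "N \<le> k"
  shows "agree_below N (theta_term k) 0"
proof -
  have "agree_below N (y ^ k * q ^ (k choose 2) - x ^ Suc k * q ^ (Suc k choose 2)) (0 - 0)"
    using assms by (intro agree_below_diff agree_below_0_power x y) simp_all
  thus ?thesis by (simp add: theta_term_def mult.commute)
qed

end

section \<open>Specialisation of the variables\<close>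

text \<open>
  With \<open>t = j choose 2\<close> the two exponents are \<open>R t + (R - S) j\<close> and \<open>R (j + t) + S (j + 1)\<close>.
\<close>

lemma tail_term_eq_theta_term:
  assumes "S < R" and "triple_product_variables (fps_X ^ S) (fps_X ^ (R - S)) (fps_X ^ R)"
  shows "tail_term R S k (k + i) =
     (-1) ^ i * triple_product_variables.theta_term (fps_X ^ S) (fps_X ^ (R - S)) (fps_X ^ R) (k + i)"
proof -
  interpret triple_product_variables "fps_X ^ S" "fps_X ^ (R - S)" "fps_X ^ R" by (rule assms(2))
  define j where "j = k + i"
  define t where "t = (j choose 2)"
  obtain D where R: "R = S + D" using assms(1) by (metis less_imp_add_positive)
  have Suc_t: "Suc j choose 2 = j + t" by (simp add: t_def numeral_2_eq_2)
  have "R * j * (j + 1) = R * (2 * (Suc j choose 2))"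
    unfolding double_choose_two by (simp only: mult.assoc Suc_eq_plus1)
  hence "R * j * (j + 1) = R * (j + t) * 2"
    by (simp add: Suc_t)
  hence "R * j * (j + 1) div 2 - S * j = R * (j + t) - S * j" by simp
  also have "\<dots> = R * t + D * j" by (simp add: R algebra_simps)
  finally have low: "R * j * (j + 1) div 2 - S * j = R * t + D * j" .
  have high: "R * t + D * j + (2 * j + 1) * S = R * (j + t) + S * Suc j"
    by (simp add: R algebra_simps)
  have "(fps_X :: rat fps) ^ (R * t + D * j) * (1 - fps_X ^ ((2 * j + 1) * S)) =
        fps_X ^ (R * t + D * j) - fps_X ^ (R * (j + t) + S * Suc j)"
    unfolding right_diff_distrib power_add[symmetric] high by simp
  thus ?thesis
    unfolding tail_term_def theta_term_def j_def[symmetric] low Suc_t t_def[symmetric]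
    by (simp add: j_def[symmetric] R power_add[symmetric] power_mult[symmetric] mult.assoc)
       (simp add: j_def)
qed

theorem corollary1p3:
  fixes k R S n :: nat
  assumes "1 \<le> k" and "1 \<le> S" and "S < R" and "1 \<le> n"
  shows "0 \<le> fps_nth (truncated_triple R S k) n"
proof -
  let ?x = "fps_X ^ S :: rat fps" and ?y = "fps_X ^ (R - S) :: rat fps" and ?q = "fps_X ^ R :: rat fps"
  interpret triple_product_variables ?x ?y ?q
    using assms by unfold_locales
      (simp_all add: nonneg_coeffs_X_power fps_X_power_nth flip: power_add)
  \<comment> \<open>Any \<open>N > n\<close> of this form would do; the tail is then cut after \<open>N + 1 - k = m\<close> terms.\<close>
  define N where "N = k + 2 * Suc n"
  define m where "m = 2 * Suc n + 1"
  define tail where "tail = (\<Sum>j. if k \<le> j then tail_term R S k j else 0)"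
  define PE where "PE = qpochhammer_inf ?x ?q * qpochhammer_inf ?y ?q"
  define E where "E = euler_sum ?q N ?x * euler_sum ?q N ?y"
  have "fps_nth PE 0 = 1"
    using has_prod_qpochhammer_inf(2)[OF x(2) q(2)] has_prod_qpochhammer_inf(2)[OF y(2) q(2)]
    by (simp add: PE_def)
  hence "truncated_triple R S k * PE = tail"
    unfolding truncated_triple_def qpochhammers_inf_def
    by (simp add: fps_divide_unit inverse_mult_eq_1 mult.assoc flip: PE_def tail_def)
  moreover have "agree_below N (PE * E) 1"
    using agree_below_mult[OF euler_sum_qpochhammer_inf[OF q(2) x(2)] euler_sum_qpochhammer_inf[OF q(2) y(2)]]
    by (simp add: PE_def E_def mult_ac)
  ultimately have "agree_below N (truncated_triple R S k) (tail * E)"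
    using agree_below_sym[OF agree_below_mult[OF agree_below_refl[of N "truncated_triple R S k"]]]
    by (metis mult.assoc mult_1_right)
  also have "agree_below N (tail * E) ((\<Sum>i<m. (-1) ^ i * theta_term (k + i)) * E)"
  proof (intro agree_below_mult agree_below_refl)
    have partial: "(\<Sum>j<k + M. if k \<le> j then tail_term R S k j else 0) =
        (\<Sum>i<M. (-1) ^ i * theta_term (k + i))" for M
      by (induction M) (simp_all add: tail_term_eq_theta_term[OF assms(3) triple_product_variables_axioms])
    have stable: "agree_below N (\<Sum>i<m + d. (-1) ^ i * theta_term (k + i)) (\<Sum>i<m. (-1) ^ i * theta_term (k + i))" for d
    proof (induction d)
      case (Suc d)
      have "agree_below N ((-1) ^ (m + d) * theta_term (k + (m + d))) ((-1) ^ (m + d) * 0)"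
        by (intro agree_below_mult agree_below_refl agree_below_0_theta_term) (simp add: N_def m_def)
      from agree_below_add[OF Suc this] show ?case by simp
    qed (simp add: agree_below_refl)
    have "(\<lambda>M. \<Sum>j<M. if k \<le> j then tail_term R S k j else 0) \<longlonglongrightarrow> tail"
      unfolding tail_def using summable_sums[OF summable_tail_terms[OF assms(3)]] by (simp add: sums_def)
    hence "\<forall>\<^sub>F M in sequentially. \<forall>i\<in>{..<N}.
        fps_nth (\<Sum>j<M. if k \<le> j then tail_term R S k j else 0) i = fps_nth tail i"
      by (intro eventually_ball_finite) (auto simp: tendsto_fps_iff)
    then obtain M0 where "\<forall>M\<ge>M0. agree_below N (\<Sum>j<M. if k \<le> j then tail_term R S k j else 0) tail"
      by (auto simp: eventually_sequentially agree_below_def)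
    hence "agree_below N (\<Sum>j<k + (m + M0). if k \<le> j then tail_term R S k j else 0) tail" by simp
    thus "agree_below N tail (\<Sum>i<m. (-1) ^ i * theta_term (k + i))"
      unfolding partial by (blast intro: agree_below_sym agree_below_trans stable)
  qed
  finally have T: "agree_below N (truncated_triple R S k) ((\<Sum>i<m. (-1) ^ i * theta_term (k + i)) * E)" .
  obtain f where f: "nonneg_coeffs f"
    and "agree_below N ((\<Sum>i<m. (-1) ^ i * theta_term (k + i)) * E) f"
    using nonneg_truncated_theta[OF assms(1), of "Suc n"] unfolding N_def m_def E_def by blast
  with T have "agree_below N (truncated_triple R S k) f" by (blast intro: agree_below_trans)
  hence "fps_nth (truncated_triple R S k) n = fps_nth f n"
    by (simp add: agree_below_def N_def)
  thus ?thesis using f by (simp add: nonneg_coeffsD)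
qed

end
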